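(* Let $\mathbb{K}$ be a field and let $\mathcal{C}$ be a binary linear code of length $n$ with code ideal $I_{\mathcal{C}}\subseteq\mathbb{K}[x_1,\dots,x_n]$. Then the universal Gröbner basis $\mathcal{U}_{\mathcal{C}}$ of $I_{\mathcal{C}}$ consists of all primitive binomials of $I_{\mathcal{C}}$; that is, $\mathcal{U}_{\mathcal{C}}$ equals the set of all primitive binomials in $I_{\mathcal{C}}$.
   Context: **Codes.** A binary $[n,k]$ code (with $n\ge k$ positive integers) is a $k$-dimensional linear subspace of $\mathbb{F}_2^n$. A generator matrix is a $k\times n$ matrix whose rows form a basis of the code. All codes are assumed to have no zero column in their generator matrices. The support of a vector is the set of indices of its non-zero entries. **Code ideal.** Write $\mathbf{x}^u=x_1^{u_1}\cdots x_n^{u_n}$, where a vector $u\in\mathbb{F}_2^n$ is used as an exponent by taking the representatives of its entries in $\{0,1\}$. The code ideal of $\mathcal{C}$ in $\mathbb{K}[x_1,\dots,x_n]$ is $$I_{\mathcal{C}}=\langle \mathbf{x}^c-\mathbf{x}^{c'}\mid c-c'\in\mathcal{C}\rangle+\langle x_i^2-1\mid 1\le i\le n\rangle .$$ **Binomials associated with codewords.** A binomial $\mathbf{x}^c-\mathbf{x}^{c'}\in I_{\mathcal{C}}$, with $c,c'\in\mathbb{F}_2^n$ both non-zero, of disjoint supports, and with $c-c'\in\mathcal{C}$, is said to be associated with the codeword $c-c'$. (For binary codes the cases $c=\mathbf{0}$ and $c'=\mathbf{0}$ are excluded, so a codeword of Hamming weight $s\ge 1$ has $2^s-2$ associated binomials.)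 **Primitive binomials.** Such a binomial $\mathbf{x}^c-\mathbf{x}^{c'}$ is called primitive if there is no other non-zero binomial $\mathbf{x}^u-\mathbf{x}^{u'}\in I_{\mathcal{C}}$ (that is, with $u\neq u'$ in $\mathbb{N}_0^n$ and $(u,u')\neq(c,c')$; here $u$ or $u'$ may be $\mathbf{0}$) such that $\mathbf{x}^u$ divides $\mathbf{x}^c$ and $\mathbf{x}^{u'}$ divides $\mathbf{x}^{c'}$. Additionally, every binomial $x_i^2-1$, $1\le i\le n$, is considered to be primitive. **Universal Gröbner basis.** $\mathcal{U}_{\mathcal{C}}$ is the union of all reduced Gröbner bases of $I_{\mathcal{C}}$, taken over all monomial orders on $\mathbb{K}[x_1,\dots,x_n]$. Elements of reduced Gröbner bases have leading coefficient $1$.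
   Formalization: The formal theorem assumes in addition that the code has no codeword of Hamming weight 1; if e_i is a codeword, x_i − 1 lies in the ideal, so x_i² − 1, declared primitive, is in no reduced Gröbner basis and the equality fails. *)

theory Defs
  imports "HOL-Analysis.Analysis" "HOL-Library.Z2" "HOL-Library.Poly_Mapping"
begin

definition binary_code :: "nat \<Rightarrow> (bit ^ 'n) set \<Rightarrow> bool" where
  "binary_code k C \<longleftrightarrow> 0 < k \<and> vec.subspace C \<and> vec.dim C = k"

definition generator_matrix :: "bit ^ 'n ^ 'k \<Rightarrow> (bit ^ 'n) set \<Rightarrow> bool" where
  "generator_matrix G C \<longleftrightarrow>
     inj (\<lambda>i. row i G) \<and> vec.independent (rows G) \<and> vec.span (rows G) = C"

definition supp :: "bit ^ 'n \<Rightarrow> 'n set" where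
  "supp c = {i. c $ i \<noteq> 0}"

definition hamming_weight :: "bit ^ 'n \<Rightarrow> nat" where
  "hamming_weight c = card (supp c)"


text \<open>
  An exponent vector is an element of \<^typ>\<open>'n \<Rightarrow>\<^sub>0 nat\<close>, with \<^typ>\<open>'n\<close> the finite
  type indexing the variables, and a polynomial is a finitely supported map from exponent vectors
  to coefficients.
\<close>

type_synonym 'n exponent = "'n \<Rightarrow>\<^sub>0 nat"
type_synonym ('n, 'a) mpoly = "'n exponent \<Rightarrow>\<^sub>0 'a"

definition monom :: "'n exponent \<Rightarrow> ('n, 'a::field) mpoly" where
  "monom u = Poly_Mapping.single u 1"

definition var :: "'n \<Rightarrow> ('n, 'a::field) mpoly" where
  "var i = monom (Poly_Mapping.single i 1)"

lift_definition expo :: "bit ^ 'n \<Rightarrow> 'n exponent" is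
  "\<lambda>c i. if c $ i = 1 then 1 else 0"
  by simp

text \<open>A commutative ring as a module over itself: its submodules are the ideals and
  \<open>ideal.span S\<close> is the ideal generated by \<open>S\<close>.\<close>

interpretation ideal: module "(*) :: 'a::comm_ring_1 \<Rightarrow> 'a \<Rightarrow> 'a"
  by unfold_locales (simp_all add: algebra_simps)

definition code_ideal :: "(bit ^ 'n) set \<Rightarrow> ('n, 'a::field) mpoly set" where
  "code_ideal C =
     {p + q | p q.
        p \<in> ideal.span {monom (expo c) - monom (expo c') | c c'. c - c' \<in> C} \<and>
        q \<in> ideal.span {(var i)\<^sup>2 - 1 | i. True}}"


text \<open>\<open>(s, t) \<in> r\<close> stands for \<open>s \<le> t\<close>. Orders in which \<open>0\<close> is the least exponent vector
  and which are compatible with addition are automatically well-orders, by Dickson's lemma.\<close>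

definition monomial_order :: "('n::finite exponent \<times> 'n exponent) set \<Rightarrow> bool" where
  "monomial_order r \<longleftrightarrow>
     linear_order r \<and> (\<forall>s. (0, s) \<in> r) \<and> (\<forall>s t u. (s, t) \<in> r \<longrightarrow> (s + u, t + u) \<in> r)"

definition lead_expo ::
  "('n exponent \<times> 'n exponent) set \<Rightarrow> ('n, 'a::field) mpoly \<Rightarrow> 'n exponent" where
  "lead_expo r p =
     (THE s. s \<in> Poly_Mapping.keys p \<and> (\<forall>t \<in> Poly_Mapping.keys p. (t, s) \<in> r))"

definition lead_coef ::
  "('n exponent \<times> 'n exponent) set \<Rightarrow> ('n, 'a::field) mpoly \<Rightarrow> 'a" where
  "lead_coef r p = Poly_Mapping.lookup p (lead_expo r p)"

definition initial_ideal ::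
  "('n exponent \<times> 'n exponent) set \<Rightarrow> ('n, 'a::field) mpoly set \<Rightarrow> ('n, 'a) mpoly set" where
  "initial_ideal r F = ideal.span {monom (lead_expo r f) | f. f \<in> F \<and> f \<noteq> 0}"

definition groebner_basis ::
  "('n exponent \<times> 'n exponent) set \<Rightarrow> ('n, 'a::field) mpoly set \<Rightarrow> ('n, 'a) mpoly set \<Rightarrow> bool" where
  "groebner_basis r I G \<longleftrightarrow>
     finite G \<and> G \<subseteq> I \<and> initial_ideal r G = initial_ideal r I"

definition reduced_groebner_basis ::
  "('n exponent \<times> 'n exponent) set \<Rightarrow> ('n, 'a::field) mpoly set \<Rightarrow> ('n, 'a) mpoly set \<Rightarrow> bool" where
  "reduced_groebner_basis r I G \<longleftrightarrow>
     groebner_basis r I G \<and>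
     (\<forall>g \<in> G. g \<noteq> 0 \<and> lead_coef r g = 1 \<and>
        (\<forall>s \<in> Poly_Mapping.keys g. monom s \<notin> initial_ideal r (G - {g})))"

definition universal_groebner_basis ::
  "('n::finite, 'a::field) mpoly set \<Rightarrow> ('n, 'a) mpoly set" where
  "universal_groebner_basis I =
     \<Union> {G. \<exists>r. monomial_order r \<and> reduced_groebner_basis r I G}"


text \<open>The binomials are tracked through their pairs of exponents, since in characteristic 2 the
  pairs \<open>(c, c')\<close> and \<open>(c', c)\<close> define the same polynomial.\<close>

definition associated_binomial ::
  "(bit ^ 'n) set \<Rightarrow> ('n, 'a::field) mpoly set \<Rightarrow> bit ^ 'n \<Rightarrow> bit ^ 'n \<Rightarrow> bool" where
  "associated_binomial C I c c' \<longleftrightarrow>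
     monom (expo c) - monom (expo c') \<in> I \<and> c \<noteq> 0 \<and> c' \<noteq> 0 \<and>
     supp c \<inter> supp c' = {} \<and> c - c' \<in> C"

definition primitive ::
  "(bit ^ 'n) set \<Rightarrow> ('n, 'a::field) mpoly set \<Rightarrow> bit ^ 'n \<Rightarrow> bit ^ 'n \<Rightarrow> bool" where
  "primitive C I c c' \<longleftrightarrow>
     associated_binomial C I c c' \<and>
     \<not> (\<exists>u u'. u \<noteq> u' \<and> (u, u') \<noteq> (expo c, expo c') \<and> monom u - monom u' \<in> I \<and>
            (monom u :: ('n, 'a) mpoly) dvd monom (expo c) \<and>
            (monom u' :: ('n, 'a) mpoly) dvd monom (expo c'))"

definition primitive_binomials :: "(bit ^ 'n) set \<Rightarrow> ('n, 'a::field) mpoly set" where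
  "primitive_binomials C =
     {monom (expo c) - monom (expo c') | c c'. primitive C (code_ideal C :: ('n, 'a) mpoly set) c c'}
     \<union> {(var i)\<^sup>2 - 1 | i. True}"

end

(* Modulo the code ideal every monomial x^u depends only on the coset of u mod 2, and the sum of
   the coefficients of an ideal element over each coset vanishes. So, for any monomial order, the
   initial ideal is spanned by the monomials that are not least in their coset, and the reduced
   Groebner basis consists of the binomials x^u - x^v with u minimal (for divisibility) outside
   the least ones and v the least element of its coset. Minimality of u makes such a binomial
   primitive or equal to x_i^2 - 1; conversely each primitive binomial is realised by an order
   that compares suitable weights. *)

theory Submission
  imports Defs
begin

text \<open>Both exponents of an associated binomial are non-zero, so squarefree binomials x^u - 1
  have to be kept out of every reduced basis even though u may be a codeword. For weight at least
  two, minimality of u does this: x_i and x^u / x_i would be two congruent standard monomials, hence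
  equal, and u would not be squarefree. A codeword of weight one escapes this argument. It would put
  x_i - 1 into the ideal and thereby remove x_i^2 - 1 from all reduced bases; hence
  \<open>no_weight_one\<close>. Cosets of exponents are infinite, but each exponent lies above its
  squarefree reduction modulo 2, which stays in the same coset. This turns existence of least
  elements and finiteness of the basis into statements about finitely many bounded
  exponents.\<close>

abbreviation lookup :: "('b \<Rightarrow>\<^sub>0 'c::zero) \<Rightarrow> 'b \<Rightarrow> 'c" where
  "lookup \<equiv> Poly_Mapping.lookup"

abbreviation keys :: "('b \<Rightarrow>\<^sub>0 'c::zero) \<Rightarrow> 'b set" where
  "keys \<equiv> Poly_Mapping.keys"

abbreviation single :: "'b \<Rightarrow> 'c \<Rightarrow> ('b \<Rightarrow>\<^sub>0 'c::zero)" where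
  "single \<equiv> Poly_Mapping.single"

section \<open>Exponents and monomials\<close>

lemma exponent_le_iff_add:
  fixes u w :: "'n \<Rightarrow>\<^sub>0 nat"
  shows "lookup u \<le> lookup w \<longleftrightarrow> (\<exists>z. w = u + z)"
proof
  assume "lookup u \<le> lookup w"
  then have "w = u + (w - u)"
    by (intro poly_mapping_eqI) (simp add: lookup_add lookup_minus le_fun_def)
  then show "\<exists>z. w = u + z" ..
qed (auto simp: le_fun_def lookup_add)

lemma exponent_antisym:
  fixes u w :: "'n \<Rightarrow>\<^sub>0 nat"
  shows "lookup u \<le> lookup w \<Longrightarrow> lookup w \<le> lookup u \<Longrightarrow> u = w"
  by (simp add: poly_mapping_eqI order_antisym)

lemma monom_mult: "monom u * monom v = (monom (u + v) :: ('n, 'a::field) mpoly)"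
  by (simp add: monom_def mult_single)

lemma lookup_monom: "lookup (monom u :: ('n, 'a::field) mpoly) v = (if u = v then 1 else 0)"
  by (simp add: monom_def lookup_single)

lemma keys_monom [simp]: "keys (monom u :: ('n, 'a::field) mpoly) = {u}"
  by (simp add: monom_def)

lemma monom_0 [simp]: "(monom 0 :: ('n, 'a::field) mpoly) = 1"
  by (simp add: monom_def)

lemma var_square: "(var i)\<^sup>2 = (monom (single i 2) :: ('n, 'a::field) mpoly)"
  by (simp add: var_def power2_eq_square monom_mult numeral_2_eq_2 flip: single_add)

lemma monom_dvd_iff:
  "(monom u :: ('n, 'a::field) mpoly) dvd monom w \<longleftrightarrow> lookup u \<le> lookup w"
proof
  assume "(monom u :: ('n, 'a) mpoly) dvd monom w"
  then obtain q :: "('n, 'a) mpoly" where q: "monom w = monom u * q"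
    by (elim dvdE)
  have "w \<in> keys (monom u * q)"
    by (simp flip: q)
  then have "w \<in> {a + b | a b. a \<in> keys (monom u :: ('n, 'a) mpoly) \<and> b \<in> keys q}"
    using keys_mult by blast
  then show "lookup u \<le> lookup w"
    by (auto simp: exponent_le_iff_add)
next
  assume "lookup u \<le> lookup w"
  then obtain z where "w = u + z"
    by (auto simp: exponent_le_iff_add)
  then show "(monom u :: ('n, 'a) mpoly) dvd monom w"
    by (metis dvd_triv_left monom_mult)
qed

lemma monom_eq_iff [simp]: "(monom u :: ('n, 'a::field) mpoly) = monom v \<longleftrightarrow> u = v"
  by (metis keys_monom singleton_inject)

lemma keys_monom_diff:
  "u \<noteq> v \<Longrightarrow> keys (monom u - monom v :: ('n, 'a::field) mpoly) = {u, v}"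
  by (auto simp: in_keys_iff lookup_minus lookup_monom split: if_splits)

text \<open>The induction proves more: every key of every element of the span is divisible by some
  member of \<open>S\<close>. Unlike the claim about a single monomial, this survives sums and
  multiples.\<close>

lemma monom_in_span_monoms_iff:
  "(monom s :: ('n, 'a::field) mpoly) \<in> ideal.span (monom ` S) \<longleftrightarrow>
     (\<exists>u\<in>S. lookup u \<le> lookup s)"
proof
  have "\<forall>s\<in>keys p. \<exists>u\<in>S. lookup u \<le> lookup s"
    if "p \<in> ideal.span (monom ` S)" for p :: "('n, 'a) mpoly"
    using that
  proof (induction rule: ideal.span_induct_alt)
    case base
    then show ?case by simp
  next
    case (step c x y)
    show ?case
    proof
      fix s assume "s \<in> keys (c * x + y)"
      then consider "s \<in> keys (c * x)" | "s \<in> keys y"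
        using keys_add[of "c * x" y] by blast
      then show "\<exists>u\<in>S. lookup u \<le> lookup s"
      proof cases
        case 1
        from step obtain u where u: "u \<in> S" "x = monom u" by blast
        have "s \<in> {a + b | a b. a \<in> keys c \<and> b \<in> keys x}"
          using 1 keys_mult by blast
        then obtain a where "s = u + a"
          using u by (auto simp: add.commute)
        then show ?thesis
          using u by (auto simp: exponent_le_iff_add)
      qed (use step in blast)
    qed
  qed
  then show "(monom s :: ('n, 'a) mpoly) \<in> ideal.span (monom ` S) \<Longrightarrow>
      \<exists>u\<in>S. lookup u \<le> lookup s"
    by fastforce
next
  assume "\<exists>u\<in>S. lookup u \<le> lookup s"
  then obtain u z where u: "u \<in> S" "s = u + z"
    by (auto simp: exponent_le_iff_add)
  have "(monom u :: ('n, 'a) mpoly) \<in> ideal.span (monom ` S)"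
    using u by (intro ideal.span_base) blast
  from ideal.span_scale[OF this, of "monom z"]
  show "(monom s :: ('n, 'a) mpoly) \<in> ideal.span (monom ` S)"
    using u by (simp add: monom_mult add.commute)
qed

lemma single_Suc_neq_0 [simp]: "single i (Suc k) \<noteq> 0"
  by (metis lookup_single_eq lookup_zero nat.distinct(1))

lemma finite_bounded_exponents: "finite {u :: 'n::finite \<Rightarrow>\<^sub>0 nat. \<forall>i. lookup u i \<le> k}"
proof (rule finite_imageD)
  show "finite (lookup ` {u :: 'n \<Rightarrow>\<^sub>0 nat. \<forall>i. lookup u i \<le> k})"
    by (rule finite_subset[OF _ finite_PiE[of UNIV "\<lambda>_. {..k}"]]) (auto simp: PiE_def)
qed (auto intro: inj_onI poly_mapping_eqI)

section \<open>Parities of exponents and the binomials of the code ideal\<close>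

text \<open>A left inverse of \<open>expo\<close> defined on all exponents, so that congruence
  modulo the code reads \<open>parity u - parity v \<in> C\<close> without first passing to
  squarefree exponents.\<close>

definition parity :: "('n \<Rightarrow>\<^sub>0 nat) \<Rightarrow> bit ^ 'n" where
  "parity u = (\<chi> i. of_nat (lookup u i))"

lemma parity_nth [simp]: "parity u $ i = of_nat (lookup u i)"
  by (simp add: parity_def)

lemma parity_add: "parity (u + v) = parity u + parity v"
  by (simp add: vec_eq_iff lookup_add)

lemma parity_0 [simp]: "parity 0 = 0"
  by (simp add: vec_eq_iff)

lemma lookup_expo: "lookup (expo c) i = (if c $ i = 1 then 1 else 0)"
  by transfer simp

lemma parity_expo [simp]: "parity (expo c) = c"
  by (simp add: vec_eq_iff lookup_expo)

lemma expo_eq_iff [simp]: "expo c = expo c' \<longleftrightarrow> c = c'"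
  by (metis parity_expo)

lemma parity_single_2 [simp]: "parity (single i 2) = 0"
  by (simp add: vec_eq_iff lookup_single when_def)

lemma of_nat_bit_eq: "(of_nat n :: bit) = (if even n then 0 else 1)"
  by (cases "even n") (auto elim!: evenE oddE)

lemma expo_parity_le: "lookup (expo (parity u)) \<le> lookup u"
  by (auto simp: le_fun_def lookup_expo of_nat_bit_eq intro: odd_pos Suc_leI)

lemma single_le_iff:
  fixes u :: "'n \<Rightarrow>\<^sub>0 nat"
  shows "lookup (single i k) \<le> lookup u \<longleftrightarrow> k \<le> lookup u i"
  by (auto simp: le_fun_def lookup_single when_def)

lemma expo_parity_eq:
  assumes "\<And>i. lookup u i < 2"
  shows "expo (parity u) = u"
proof (rule poly_mapping_eqI)
  fix i
  show "lookup (expo (parity u)) i = lookup u i"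
    using assms[of i] by (auto simp: lookup_expo of_nat_bit_eq less_2_cases_iff)
qed

section \<open>The code ideal and reduction to squarefree monomials\<close>

lemma code_ideal_span:
  "code_ideal C = (ideal.span ({monom (expo c) - monom (expo c') | c c'. c - c' \<in> C} \<union>
     {(var i)\<^sup>2 - 1 | i. True}) :: ('n::finite, 'a::field) mpoly set)"
  unfolding code_ideal_def ideal.span_Un by blast

lemma code_ideal_scale: "p \<in> code_ideal C \<Longrightarrow> q * p \<in> code_ideal C"
  unfolding code_ideal_span by (rule ideal.span_scale)

lemma code_ideal_trans:
  "monom u - monom v \<in> (code_ideal C :: ('n::finite, 'a::field) mpoly set) \<Longrightarrow>
   monom v - monom w \<in> (code_ideal C :: ('n, 'a) mpoly set) \<Longrightarrow>
   monom u - monom w \<in> (code_ideal C :: ('n, 'a) mpoly set)"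
  unfolding code_ideal_span using ideal.span_add by fastforce

lemma code_ideal_sym:
  "monom u - monom v \<in> (code_ideal C :: ('n::finite, 'a::field) mpoly set) \<Longrightarrow>
   monom v - monom u \<in> (code_ideal C :: ('n, 'a) mpoly set)"
  unfolding code_ideal_span using ideal.span_neg by fastforce

text \<open>Descent on the total degree: as long as some x_i^2 divides the monomial, a multiple of
  x_i^2 - 1 removes that factor and leaves the parity unchanged.\<close>

lemma code_ideal_monom_parity:
  "monom u - monom (expo (parity u)) \<in> (code_ideal C :: ('n::finite, 'a::field) mpoly set)"
proof (induction "sum (lookup u) UNIV" arbitrary: u rule: less_induct)
  case less
  show ?case
  proof (cases "\<exists>i. 2 \<le> lookup u i")
    case False
    then have "expo (parity u) = u"
      by (intro expo_parity_eq) (meson not_le)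
    then show ?thesis
      by (simp add: code_ideal_span ideal.span_zero)
  next
    case True
    then obtain i v where u: "u = single i 2 + v"
      by (metis single_le_iff exponent_le_iff_add)
    have "((var i)\<^sup>2 - 1 :: ('n, 'a) mpoly) \<in> code_ideal C"
      unfolding code_ideal_span by (intro ideal.span_base) blast
    from code_ideal_scale[OF this, of "monom v"]
    have "monom u - monom v \<in> (code_ideal C :: ('n, 'a) mpoly set)"
      by (simp add: u var_square monom_mult right_diff_distrib add.commute)
    moreover have "sum (lookup v) UNIV < sum (lookup u) UNIV"
      by (simp add: u lookup_add sum.distrib lookup_single when_def)
    ultimately show ?thesis
      using less[of v] by (auto simp: u parity_add intro: code_ideal_trans)
  qed
qed

text \<open>For a subspace \<open>C\<close>, this is the coefficient at a + C of the image of p in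
  the group algebra of the quotient by \<open>C\<close>, under the map sending x^u to the class of
  \<open>parity u\<close>.\<close>

definition coset_sum ::
  "(bit ^ 'n) set \<Rightarrow> bit ^ 'n \<Rightarrow> ('n, 'a::field) mpoly \<Rightarrow> 'a" where
  "coset_sum C a p = (\<Sum>u\<in>keys p. if parity u - a \<in> C then lookup p u else 0)"

lemma coset_sum_superset:
  assumes "finite X" "keys p \<subseteq> X"
  shows "coset_sum C a p = (\<Sum>u\<in>X. if parity u - a \<in> C then lookup p u else 0)"
  unfolding coset_sum_def using assms
  by (intro sum.mono_neutral_left) (auto simp: in_keys_iff)

lemma coset_sum_add: "coset_sum C a (p + q) = coset_sum C a p + coset_sum C a q"
  using keys_add[of p q]
  by (simp add: coset_sum_superset[of "keys p \<union> keys q"] lookup_add flip: sum.distrib)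
    (intro sum.cong refl, simp add: lookup_add)

lemma coset_sum_diff: "coset_sum C a (p - q) = coset_sum C a p - coset_sum C a q"
  using coset_sum_add[of C a "p - q" q] by simp

lemma coset_sum_single: "coset_sum C a (single u b) = (if parity u - a \<in> C then b else 0)"
  by (simp add: coset_sum_def)

lemma coset_sum_0 [simp]: "coset_sum C a 0 = 0"
  by (simp add: coset_sum_def)

lemma mpoly_induct [case_names zero single_add]:
  fixes p :: "'b \<Rightarrow>\<^sub>0 'c::comm_monoid_add"
  assumes "P 0" and step: "\<And>u b p. P p \<Longrightarrow> P (single u b + p)"
  shows "P p"
proof (induction p rule: update_induct)
  case const
  then show ?case by (rule assms)
next
  case (update p u b)
  have "Poly_Mapping.update u b p = single u b + p"
    using update
    by (intro poly_mapping_eqI) (auto simp: lookup_update lookup_add lookup_single in_keys_iff)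
  then show ?case
    using step update by simp
qed

text \<open>A term b x^w of p contributes b at w + u and -b at w + v. These exponents lie in the
  same coset, so both contributions count or neither does.\<close>

lemma coset_sum_mult_binomial:
  assumes C: "vec.subspace C" and "parity u - parity v \<in> C"
  shows "coset_sum C a (p * (monom u - monom v)) = 0"
proof (induction p rule: mpoly_induct)
  case (single_add w b p)
  have "parity (w + u) - a \<in> C \<longleftrightarrow> parity (w + v) - a \<in> C"
    using assms vec.subspace_diff[OF C, of "parity (w + u) - a" "parity u - parity v"]
      vec.subspace_add[OF C, of "parity (w + v) - a" "parity u - parity v"]
    by (auto simp: parity_add algebra_simps)
  then show ?case
    using single_add
    by (simp add: distrib_right coset_sum_add right_diff_distrib coset_sum_diff
        coset_sum_single monom_def mult_single)
qed simp

lemma coset_sum_code_ideal: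
  assumes C: "vec.subspace C" and "p \<in> code_ideal C"
  shows "coset_sum C a p = 0"
  using assms(2) unfolding code_ideal_span
proof (induction rule: ideal.span_induct_alt)
  case (step c x y)
  \<comment> \<open>Both families of generators have this shape; x_i^2 - 1 does because the
    exponents 2 e_i and 0 have parity zero.\<close>
  from step(1) obtain u v where "x = monom u - monom v" "parity u - parity v \<in> C"
  proof
    assume "x \<in> {monom (expo c) - monom (expo c') | c c'. c - c' \<in> C}"
    then show ?thesis using that by force
  next
    assume "x \<in> {(var i)\<^sup>2 - 1 | i. True}"
    then obtain i where "x = monom (single i 2) - monom 0"
      by (auto simp: var_square)
    then show ?thesis
      using that[of "single i 2" 0] vec.subspace_0[OF C] by simp
  qed
  then show ?case
    using step(2) by (simp add: coset_sum_add coset_sum_mult_binomial[OF C])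
qed simp

text \<open>If u and v were not congruent, the coefficients over the coset of v would sum to -1
  instead of 0. Conversely, both monomials reduce to squarefree ones whose difference is a
  generator.\<close>

lemma binomial_in_code_ideal_iff:
  assumes C: "vec.subspace C"
  shows "(monom u - monom v :: ('n::finite, 'a::field) mpoly) \<in> code_ideal C \<longleftrightarrow>
    parity u - parity v \<in> C"
proof
  assume "(monom u - monom v :: ('n::finite, 'a::field) mpoly) \<in> code_ideal C"
  from coset_sum_code_ideal[OF C this, of "parity v"]
  show "parity u - parity v \<in> C"
    using vec.subspace_0[OF C]
    by (auto simp: coset_sum_diff monom_def coset_sum_single split: if_splits)
next
  assume "parity u - parity v \<in> C"
  then have "(monom (expo (parity u)) - monom (expo (parity v)) :: ('n, 'a) mpoly) \<in> code_ideal C"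
    unfolding code_ideal_span by (intro ideal.span_base) blast
  then show "(monom u - monom v :: ('n::finite, 'a::field) mpoly) \<in> code_ideal C"
    by (meson code_ideal_monom_parity code_ideal_sym code_ideal_trans)
qed

section \<open>Reduced Groebner bases of the code ideal\<close>

text \<open>These are the standard monomials in the usual sense, those outside the initial ideal;
  see \<open>monom_in_initial_code_ideal_iff\<close>.\<close>

definition standard ::
  "(bit ^ 'n) set \<Rightarrow> ('n::finite exponent \<times> 'n exponent) set \<Rightarrow> 'n exponent \<Rightarrow> bool" where
  "standard C r u \<longleftrightarrow> (\<forall>w. parity w - parity u \<in> C \<longrightarrow> (u, w) \<in> r)"

definition min_nonstandard ::
  "(bit ^ 'n) set \<Rightarrow> ('n::finite exponent \<times> 'n exponent) set \<Rightarrow> 'n exponent \<Rightarrow> bool" where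
  "min_nonstandard C r u \<longleftrightarrow>
     \<not> standard C r u \<and> (\<forall>w. lookup w \<le> lookup u \<longrightarrow> w \<noteq> u \<longrightarrow> standard C r w)"

lemma linear_order_ex_greatest:
  assumes "linear_order r" "finite X" "X \<noteq> {}"
  shows "\<exists>m\<in>X. \<forall>x\<in>X. (x, m) \<in> r"
  using assms(2,3)
proof (induction rule: finite_ne_induct)
  case (singleton x)
  then show ?case
    using assms(1) by (auto simp: order_on_defs refl_on_def)
next
  case (insert x F)
  then obtain m where m: "m \<in> F" "\<forall>y\<in>F. (y, m) \<in> r" by blast
  have r: "refl r" "trans r" "total r"
    using assms(1) by (auto simp: order_on_defs)
  then consider "(x, m) \<in> r" | "(m, x) \<in> r" "(x, x) \<in> r"
    by (metis UNIV_I refl_onD total_on_def)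
  then show ?case
  proof cases
    case 1
    then show ?thesis using m by blast
  next
    case 2
    then have "\<forall>y\<in>insert x F. (y, x) \<in> r"
      using m r(2) by (auto dest: transD)
    then show ?thesis by blast
  qed
qed

lemma lead_expo_eqI:
  assumes "linear_order r" "s \<in> keys p" "\<And>t. t \<in> keys p \<Longrightarrow> (t, s) \<in> r"
  shows "lead_expo r p = s"
  unfolding lead_expo_def using assms
  by (intro the_equality) (auto simp: order_on_defs antisym_def)

lemma lead_expo_greatest:
  assumes "linear_order r" "p \<noteq> 0"
  shows "lead_expo r p \<in> keys p" "t \<in> keys p \<Longrightarrow> (t, lead_expo r p) \<in> r"
proof -
  obtain m where "m \<in> keys p" "\<forall>x\<in>keys p. (x, m) \<in> r"
    using linear_order_ex_greatest[of r "keys p"] assms by auto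
  then show "lead_expo r p \<in> keys p" "t \<in> keys p \<Longrightarrow> (t, lead_expo r p) \<in> r"
    using lead_expo_eqI[OF assms(1)] by metis+
qed

lemma initial_ideal_image: "initial_ideal r F = ideal.span (monom ` lead_expo r ` (F - {0}))"
  unfolding initial_ideal_def by (rule arg_cong[of _ _ ideal.span]) auto

lemma monom_in_initial_ideal_iff:
  "monom s \<in> initial_ideal r F \<longleftrightarrow>
     (\<exists>f\<in>F. f \<noteq> 0 \<and> lookup (lead_expo r f) \<le> lookup s)"
  by (auto simp: initial_ideal_image monom_in_span_monoms_iff)

section \<open>Standard exponents and normal forms for a fixed order\<close>

locale code_order =
  fixes C :: "(bit ^ 'n) set" and r :: "('n exponent \<times> 'n exponent) set"
  assumes subspace: "vec.subspace C" and order: "monomial_order r"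
begin

lemma linear: "linear_order r"
  using order by (simp add: monomial_order_def)

lemma r_refl [simp]: "(u, u) \<in> r"
  using linear by (auto simp: order_on_defs refl_on_def)

lemma r_antisym: "(u, v) \<in> r \<Longrightarrow> (v, u) \<in> r \<Longrightarrow> u = v"
  using linear by (auto simp: order_on_defs antisym_def)

lemma r_total: "(u, v) \<in> r \<or> (v, u) \<in> r"
  using linear by (cases "u = v") (auto simp: order_on_defs total_on_def)

lemma r_zero [simp]: "(0, u) \<in> r"
  using order by (simp add: monomial_order_def)

lemma r_add: "(u, v) \<in> r \<Longrightarrow> (u + w, v + w) \<in> r"
  using order by (simp add: monomial_order_def)

lemma r_trans: "(u, v) \<in> r \<Longrightarrow> (v, w) \<in> r \<Longrightarrow> (u, w) \<in> r"
  using linear by (auto simp: order_on_defs dest: transD)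

lemma r_of_le: "lookup u \<le> lookup w \<Longrightarrow> (u, w) \<in> r"
  using r_add[OF r_zero, of u] by (auto simp: exponent_le_iff_add add.commute)

lemma cong_sym: "parity u - parity v \<in> C \<Longrightarrow> parity v - parity u \<in> C"
  using vec.subspace_neg[OF subspace] by fastforce

lemma cong_trans: "parity u - parity v \<in> C \<Longrightarrow> parity v - parity w \<in> C \<Longrightarrow> parity u - parity w \<in> C"
  using vec.subspace_add[OF subspace] by fastforce

text \<open>If some v below u were congruent to u, then multiplying both by the cofactor z would
  give an element v + z below w in the coset of w.\<close>

lemma standard_le:
  assumes "standard C r w" "lookup u \<le> lookup w"
  shows "standard C r u"
  unfolding standard_def
proof (intro allI impI)
  fix v assume v: "parity v - parity u \<in> C"
  obtain z where z: "w = u + z"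
    using assms(2) by (auto simp: exponent_le_iff_add)
  have "(u + z, v + z) \<in> r"
    using assms(1) v by (simp add: standard_def z parity_add)
  then show "(u, v) \<in> r"
    using r_total[of u v] r_add[of v u z] r_antisym[of "u + z" "v + z"] by auto
qed

lemma standard_unique:
  "standard C r u \<Longrightarrow> standard C r v \<Longrightarrow> parity u - parity v \<in> C \<Longrightarrow> u = v"
  using r_antisym cong_sym by (auto simp: standard_def)

text \<open>The least element is sought in a finite set only: every w in the coset lies above
  \<open>expo (parity w)\<close>, which belongs to \<open>X\<close>, so the least element of
  \<open>X\<close> is least in the whole coset. The converse relation turns greatest into
  least.\<close>

lemma ex_standard: "\<exists>v. standard C r v \<and> parity v - parity u \<in> C"
proof -
  define X where "X = {v. (\<forall>i. lookup v i \<le> 2) \<and> parity v - parity u \<in> C}"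
  have "expo (parity u) \<in> X"
    using vec.subspace_0[OF subspace] by (simp add: X_def lookup_expo)
  moreover have "finite X"
    unfolding X_def by (rule finite_subset[OF _ finite_bounded_exponents[of 2]]) blast
  moreover have "linear_order (r\<inverse>)"
    using linear by simp
  ultimately obtain m where m: "m \<in> X" "\<And>x. x \<in> X \<Longrightarrow> (m, x) \<in> r"
    using linear_order_ex_greatest[of "r\<inverse>" X] by auto
  have "(m, w) \<in> r" if "parity w - parity m \<in> C" for w
  proof -
    have "expo (parity w) \<in> X"
      using m(1) that cong_trans[of w m u] by (simp add: X_def lookup_expo)
    then show ?thesis
      using m(2) r_of_le[OF expo_parity_le] r_trans by blast
  qed
  then show ?thesis
    using m(1) by (auto simp: standard_def X_def)
qed

definition normal_form :: "'n exponent \<Rightarrow> 'n exponent" where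
  "normal_form u = (SOME v. standard C r v \<and> parity v - parity u \<in> C)"

lemma standard_normal_form: "standard C r (normal_form u)"
  and normal_form_cong: "parity (normal_form u) - parity u \<in> C"
  using someI_ex[OF ex_standard[of u]] by (auto simp: normal_form_def)

lemma normal_form_le: "(normal_form u, u) \<in> r"
  using standard_normal_form[of u] cong_sym[OF normal_form_cong[of u]]
  by (simp add: standard_def)

lemma normal_form_eqI: "standard C r v \<Longrightarrow> parity v - parity u \<in> C \<Longrightarrow> normal_form u = v"
  by (meson standard_normal_form normal_form_cong standard_unique cong_sym cong_trans)

lemma nonstandard_single_2: "\<not> standard C r (single i 2)"
proof
  assume "standard C r (single i 2)"
  then have "(single i 2, 0) \<in> r"
    using vec.subspace_0[OF subspace] by (simp add: standard_def)
  then have "single i 2 = (0 :: 'n exponent)"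
    using r_antisym r_zero by blast
  then show False
    by (metis lookup_single_eq lookup_zero zero_neq_numeral)
qed

text \<open>All squares x_i^2 are nonstandard, since they are congruent to 1; a minimal nonstandard
  monomial divisible by one of them must therefore equal it.\<close>

lemma min_nonstandard_cases:
  assumes "min_nonstandard C r u"
  obtains i where "u = single i 2" | "expo (parity u) = u"
proof (cases "\<forall>i. lookup u i < 2")
  case True
  then show ?thesis
    using that(2) expo_parity_eq by blast
next
  case False
  then obtain i where "lookup (single i 2) \<le> lookup u"
    by (auto simp: single_le_iff not_less)
  then have "single i 2 = u"
    using assms nonstandard_single_2[of i] unfolding min_nonstandard_def by blast
  then show ?thesis
    using that(1) by blast
qed

text \<open>In both cases above the entries are at most 2, which takes the place of Dickson's
  lemma.\<close>

lemma finite_min_nonstandard: "finite {u. min_nonstandard C r u}"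
proof (rule finite_subset[OF _ finite_bounded_exponents[of 2]])
  show "{u. min_nonstandard C r u} \<subseteq> {u. \<forall>i. lookup u i \<le> 2}"
  proof safe
    fix u i assume "min_nonstandard C r u"
    then show "lookup u i \<le> 2"
    proof (cases rule: min_nonstandard_cases)
      case (1 j)
      then show ?thesis by (simp add: lookup_single when_def)
    next
      case 2
      then show ?thesis
        using lookup_expo[of "parity u" i] by (simp split: if_splits)
    qed
  qed
qed

lemma ex_min_nonstandard:
  "\<not> standard C r u \<Longrightarrow> \<exists>w. min_nonstandard C r w \<and> lookup w \<le> lookup u"
proof (induction "sum (lookup u) UNIV" arbitrary: u rule: less_induct)
  case less
  show ?case
  proof (cases "min_nonstandard C r u")
    case False
    then obtain w where w: "lookup w \<le> lookup u" "w \<noteq> u" "\<not> standard C r w"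
      using less.prems by (auto simp: min_nonstandard_def)
    obtain z where z: "u = w + z"
      using w by (auto simp: exponent_le_iff_add)
    with w(2) obtain i where "lookup z i \<noteq> 0"
      by (metis add_0_right poly_mapping_eqI lookup_zero)
    then have "0 < sum (lookup z) UNIV"
      by (intro sum_pos2[of UNIV i]) auto
    then have "sum (lookup w) UNIV < sum (lookup u) UNIV"
      by (simp add: z lookup_add sum.distrib)
    then show ?thesis
      using less.hyps w by (meson order_trans)
  qed blast
qed

section \<open>Leading exponents, the initial ideal and the reduced basis\<close>

lemma lead_expo_binomial:
  assumes "(v, u) \<in> r" "u \<noteq> v"
  shows "lead_expo r (monom u - monom v :: ('n, 'a::field) mpoly) = u"
  using assms by (intro lead_expo_eqI linear) (auto simp: keys_monom_diff)

text \<open>Any key congruent to a standard leading exponent is both above it and below it, hence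
  equal to it. The sum over its coset would then be the leading coefficient alone, which is not
  zero.\<close>

lemma lead_expo_nonstandard:
  fixes p :: "('n, 'a::field) mpoly"
  assumes "p \<in> code_ideal C" "p \<noteq> 0"
  shows "\<not> standard C r (lead_expo r p)"
proof
  let ?u = "lead_expo r p"
  assume std: "standard C r ?u"
  note lead = lead_expo_greatest[OF linear assms(2)]
  have "w = ?u" if "w \<in> keys p" "parity w - parity ?u \<in> C" for w
    using that std lead r_antisym by (auto simp: standard_def)
  then have "coset_sum C (parity ?u) p = (\<Sum>w\<in>keys p. if w = ?u then lookup p ?u else 0)"
    unfolding coset_sum_def using vec.subspace_0[OF subspace]
    by (intro sum.cong refl) auto
  also have "\<dots> = lookup p ?u"
    using lead(1) by simp
  finally show False
    using coset_sum_code_ideal[OF subspace assms(1)] lead(1) by (simp add: in_keys_iff)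
qed

lemma normal_form_neq: "\<not> standard C r u \<Longrightarrow> u \<noteq> normal_form u"
  using standard_normal_form[of u] by auto

lemma lead_expo_normal_form:
  "\<not> standard C r u \<Longrightarrow>
   lead_expo r (monom u - monom (normal_form u) :: ('n, 'a::field) mpoly) = u"
  by (intro lead_expo_binomial normal_form_le normal_form_neq)

lemma normal_form_binomial_in_ideal:
  "(monom u - monom (normal_form u) :: ('n, 'a::field) mpoly) \<in> code_ideal C"
  by (simp add: binomial_in_code_ideal_iff[OF subspace] cong_sym normal_form_cong)

lemma monom_in_initial_code_ideal_iff:
  "monom s \<in> initial_ideal r (code_ideal C :: ('n, 'a::field) mpoly set) \<longleftrightarrow> \<not> standard C r s"
proof
  assume "monom s \<in> initial_ideal r (code_ideal C :: ('n, 'a::field) mpoly set)"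
  then show "\<not> standard C r s"
    unfolding monom_in_initial_ideal_iff using lead_expo_nonstandard standard_le by blast
next
  assume *: "\<not> standard C r s"
  then have "(monom s - monom (normal_form s) :: ('n, 'a) mpoly) \<noteq> 0"
    using normal_form_neq by simp
  then show "monom s \<in> initial_ideal r (code_ideal C :: ('n, 'a::field) mpoly set)"
    unfolding monom_in_initial_ideal_iff
    using lead_expo_normal_form[OF *] normal_form_binomial_in_ideal by (metis order_refl)
qed

text \<open>Reducedness makes the leading exponent minimal nonstandard and all other keys standard.
  Vanishing of the coset sums then leaves room for one further term only.\<close>

lemma reduced_groebner_basis_mem:
  fixes G :: "('n, 'a::field) mpoly set"
  assumes "reduced_groebner_basis r (code_ideal C) G" "g \<in> G"
  obtains u where "min_nonstandard C r u" "g = monom u - monom (normal_form u)"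
proof -
  let ?u = "lead_expo r g"
  have sub: "G \<subseteq> code_ideal C"
    and init: "initial_ideal r G = initial_ideal r (code_ideal C)"
    and g: "g \<noteq> 0" "lookup g ?u = 1"
    and red: "\<And>s. s \<in> keys g \<Longrightarrow> monom s \<notin> initial_ideal r (G - {g})"
    using assms
    by (auto simp: reduced_groebner_basis_def groebner_basis_def lead_coef_def)
  note lead = lead_expo_greatest[OF linear g(1)]
  have gI: "g \<in> code_ideal C"
    using sub assms(2) by blast
  have nonstd_u: "\<not> standard C r ?u"
    by (rule lead_expo_nonstandard[OF gI g(1)])
  \<comment> \<open>The leading exponent of some f in \<open>G\<close> divides s, hence the key t of
    g; reducedness leaves only f = g.\<close>
  have divisor: "lookup ?u \<le> lookup s"
    if s: "\<not> standard C r s" "lookup s \<le> lookup t" "t \<in> keys g" for s t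
  proof -
    have "monom s \<in> initial_ideal r G"
      using s(1) monom_in_initial_code_ideal_iff init by blast
    then obtain f where f: "f \<in> G" "f \<noteq> 0" "lookup (lead_expo r f) \<le> lookup s"
      by (auto simp: monom_in_initial_ideal_iff)
    have "f = g"
      using red[OF s(3)] f s(2) unfolding monom_in_initial_ideal_iff
      by (meson DiffI order_trans singletonD)
    then show ?thesis
      using f by simp
  qed
  have min: "min_nonstandard C r ?u"
    unfolding min_nonstandard_def using nonstd_u divisor lead(1) exponent_antisym by blast
  have tail: "standard C r t" if "t \<in> keys g" "t \<noteq> ?u" for t
  proof (rule ccontr)
    assume "\<not> standard C r t"
    then have "(?u, t) \<in> r"
      using divisor[of t t] that(1) r_of_le by simp
    then show False
      using lead(2)[OF that(1)] that(2) r_antisym by blast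
  qed
  let ?v = "normal_form ?u"
  have uv: "?u \<noteq> ?v"
    using nonstd_u standard_normal_form[of ?u] by auto
  have coset: "coset_sum C a g = 0" for a
    by (rule coset_sum_code_ideal[OF subspace gI])
  \<comment> \<open>Such a t would be the only key of g in its coset: congruent standard exponents
    coincide, and the leading exponent is congruent to no standard exponent other than
    \<open>?v\<close>.\<close>
  have other: "lookup g t = 0" if t: "t \<noteq> ?u" "t \<noteq> ?v" for t
  proof (rule ccontr)
    assume "lookup g t \<noteq> 0"
    then have t_key: "t \<in> keys g"
      by (simp add: in_keys_iff)
    have std: "standard C r t"
      by (rule tail[OF t_key t(1)])
    have "w = t" if w: "w \<in> keys g" "parity w - parity t \<in> C" for w
    proof (cases "w = ?u")
      case True
      then have "?v = t"
        using w(2) std cong_sym normal_form_eqI by blast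
      then show ?thesis using t by blast
    next
      case False
      then show ?thesis
        using tail w std standard_unique by blast
    qed
    then have "coset_sum C (parity t) g = (\<Sum>w\<in>keys g. if w = t then lookup g t else 0)"
      unfolding coset_sum_def using vec.subspace_0[OF subspace]
      by (intro sum.cong refl) auto
    then show False
      using coset \<open>lookup g t \<noteq> 0\<close> t_key by simp
  qed
  have "keys g \<subseteq> {?u, ?v}"
    using other by (auto simp: in_keys_iff)
  from coset_sum_superset[OF _ this, of C "parity ?u"]
  have "lookup g ?u + lookup g ?v = 0"
    using uv coset vec.subspace_0[OF subspace] normal_form_cong[of ?u] by simp
  then have v: "lookup g ?v = - 1"
    using g(2) by (metis add.commute add_eq_0_iff)
  have "g = monom ?u - monom ?v"
  proof (rule poly_mapping_eqI)
    fix t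
    show "lookup g t = lookup (monom ?u - monom ?v) t"
      using other[of t] g(2) v uv by (auto simp: lookup_minus lookup_monom)
  qed
  then show ?thesis
    using that min by blast
qed

text \<open>Minimal nonstandard exponents divide every nonstandard one but not each other, and the
  tails are standard, so no nonstandard exponent divides them.\<close>

lemma reduced_groebner_basis_normal_forms:
  "reduced_groebner_basis r (code_ideal C :: ('n, 'a::field) mpoly set)
     {monom u - monom (normal_form u) | u. min_nonstandard C r u}"
proof -
  define b :: "'n exponent \<Rightarrow> ('n, 'a) mpoly" where "b u = monom u - monom (normal_form u)" for u
  define M where "M = {u. min_nonstandard C r u}"
  have nonstd: "\<not> standard C r u" if "u \<in> M" for u
    using that by (simp add: M_def min_nonstandard_def)
  have lead: "lead_expo r (b u) = u" "b u \<noteq> 0" if "u \<in> M" for u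
    using lead_expo_normal_form[OF nonstd[OF that]] normal_form_neq[OF nonstd[OF that]]
    by (simp_all add: b_def)
  have "initial_ideal r (b ` M) = initial_ideal r (code_ideal C)"
  proof
    show "initial_ideal r (b ` M) \<subseteq> initial_ideal r (code_ideal C)"
      unfolding initial_ideal_image using normal_form_binomial_in_ideal
      by (intro ideal.span_mono image_mono Diff_mono) (auto simp: b_def)
    show "initial_ideal r (code_ideal C) \<subseteq> initial_ideal r (b ` M)"
    proof -
      have "monom (lead_expo r p) \<in> initial_ideal r (b ` M)"
        if p: "p \<in> code_ideal C" "p \<noteq> 0" for p :: "('n, 'a) mpoly"
      proof -
        obtain w where w: "w \<in> M" "lookup w \<le> lookup (lead_expo r p)"
          using ex_min_nonstandard lead_expo_nonstandard[OF p] unfolding M_def by blast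
        then show "monom (lead_expo r p) \<in> initial_ideal r (b ` M)"
          unfolding monom_in_initial_ideal_iff using lead by (intro bexI[of _ "b w"]) auto
      qed
      then have "monom ` lead_expo r ` ((code_ideal C :: ('n, 'a) mpoly set) - {0}) \<subseteq> initial_ideal r (b ` M)"
        by blast
      then show ?thesis
        unfolding initial_ideal_image by (intro ideal.span_minimal ideal.subspace_span)
    qed
  qed
  then have gb: "groebner_basis r (code_ideal C) (b ` M)"
    using finite_min_nonstandard normal_form_binomial_in_ideal
    by (auto simp: groebner_basis_def M_def b_def)
  have "lead_coef r (b u) = 1" if "u \<in> M" for u
    using normal_form_neq[OF nonstd[OF that]]
    by (simp add: lead_coef_def lead[OF that]) (auto simp: b_def lookup_minus lookup_monom)
  moreover have "monom s \<notin> initial_ideal r (b ` M - {b u})" if u: "u \<in> M" and s: "s \<in> keys (b u)" for s u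
  proof
    assume "monom s \<in> initial_ideal r (b ` M - {b u})"
    then obtain w where "w \<in> M" "b w \<noteq> b u" "lookup (lead_expo r (b w)) \<le> lookup s"
      by (auto simp: monom_in_initial_ideal_iff)
    then have w: "w \<in> M" "w \<noteq> u" "lookup w \<le> lookup s"
      using lead by auto
    have "s = u \<or> s = normal_form u"
      using s normal_form_neq[OF nonstd[OF u]] by (simp add: b_def keys_monom_diff)
    then show False
    proof
      assume "s = u"
      then show False
        using w u nonstd[OF w(1)] by (simp add: M_def min_nonstandard_def)
    next
      assume "s = normal_form u"
      then show False
        using w standard_le standard_normal_form nonstd[OF w(1)] by blast
    qed
  qed
  ultimately have "reduced_groebner_basis r (code_ideal C) (b ` M)"
    using gb lead by (auto simp: reduced_groebner_basis_def)
  moreover have "b ` M = {monom u - monom (normal_form u) | u. min_nonstandard C r u}"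
    by (auto simp: b_def M_def)
  ultimately show ?thesis
    by simp
qed

end

text \<open>This eliminates Groebner bases from the problem and leaves cosets of exponents and
  orders. The tail v is described by its properties, since \<open>normal_form\<close> is tied to one
  fixed order.\<close>

lemma universal_groebner_basis_code_ideal:
  fixes C :: "(bit ^ 'n) set"
  assumes C: "vec.subspace C"
  shows "universal_groebner_basis (code_ideal C :: ('n, 'a::field) mpoly set) =
    {monom u - monom v | u v. \<exists>r. monomial_order r \<and> min_nonstandard C r u \<and>
       standard C r v \<and> parity v - parity u \<in> C}"
proof safe
  fix g :: "('n, 'a) mpoly" assume "g \<in> universal_groebner_basis (code_ideal C)"
  then obtain r G where r: "monomial_order r"
    and G: "reduced_groebner_basis r (code_ideal C) G" "g \<in> G"
    by (auto simp: universal_groebner_basis_def)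
  interpret code_order C r
    using C r by unfold_locales
  obtain u where "min_nonstandard C r u" "g = monom u - monom (normal_form u)"
    using reduced_groebner_basis_mem[OF G] .
  then show "\<exists>u v. g = monom u - monom v \<and> (\<exists>r. monomial_order r \<and>
      min_nonstandard C r u \<and> standard C r v \<and> parity v - parity u \<in> C)"
    using r standard_normal_form normal_form_cong by blast
next
  fix u v r assume r: "monomial_order r" and uv: "min_nonstandard C r u"
    "standard C r v" "parity v - parity u \<in> C"
  interpret code_order C r
    using C r by unfold_locales
  have "normal_form u = v"
    using uv by (intro normal_form_eqI)
  then have "(monom u - monom v :: ('n, 'a) mpoly) \<in>
      {monom u - monom (normal_form u) | u. min_nonstandard C r u}"
    using uv by blast
  then show "(monom u - monom v :: ('n, 'a) mpoly) \<in> universal_groebner_basis (code_ideal C)"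
    unfolding universal_groebner_basis_def
    using r reduced_groebner_basis_normal_forms by blast
qed

section \<open>Monomial orders given by weights\<close>

definition weight :: "('n \<Rightarrow> nat) \<Rightarrow> 'n::finite exponent \<Rightarrow> nat" where
  "weight w u = (\<Sum>i\<in>UNIV. w i * lookup u i)"

lemma weight_add: "weight w (u + v) = weight w u + weight w v"
  by (simp add: weight_def lookup_add distrib_left sum.distrib)

lemma weight_0 [simp]: "weight w 0 = 0"
  by (simp add: weight_def)

lemma weight_unit: "weight (\<lambda>j. of_bool (i = j)) u = lookup u i"
  by (simp add: weight_def if_distrib)

lemma weight_mono: "lookup u \<le> lookup v \<Longrightarrow> weight w u \<le> weight w v"
  by (simp add: weight_def le_fun_def sum_mono)

lemma weight_ge: "w i * lookup u i \<le> weight w u"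
  unfolding weight_def by (rule member_le_sum) auto

lemma weight_expo: "weight w (expo c) = sum w (supp c)"
proof -
  have "weight w (expo c) = (\<Sum>i\<in>UNIV. if i \<in> supp c then w i else 0)"
    unfolding weight_def by (intro sum.cong) (auto simp: lookup_expo supp_def)
  then show ?thesis
    by (simp add: sum.If_cases)
qed

text \<open>A matrix order whose rows are the weights. Being natural numbers, the weights make 0
  least, and their additivity gives compatibility; antisymmetry holds once the rows separate
  exponents.\<close>

fun weights_le :: "('n \<Rightarrow> nat) list \<Rightarrow> 'n::finite exponent \<Rightarrow> 'n exponent \<Rightarrow> bool" where
  "weights_le [] u v \<longleftrightarrow> True"
| "weights_le (w # ws) u v \<longleftrightarrow>
     weight w u < weight w v \<or> weight w u = weight w v \<and> weights_le ws u v"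

lemma weights_le_refl: "weights_le ws u u"
  by (induction ws) auto

lemma weights_le_total: "weights_le ws u v \<or> weights_le ws v u"
  by (induction ws) auto

lemma weights_le_trans: "weights_le ws u v \<Longrightarrow> weights_le ws v x \<Longrightarrow> weights_le ws u x"
  by (induction ws) auto

lemma weights_le_zero: "weights_le ws 0 u"
  by (induction ws) auto

lemma weights_le_add: "weights_le ws u v \<Longrightarrow> weights_le ws (u + x) (v + x)"
  by (induction ws) (auto simp: weight_add)

lemma weights_le_antisym:
  "weights_le ws u v \<Longrightarrow> weights_le ws v u \<Longrightarrow> w \<in> set ws \<Longrightarrow> weight w u = weight w v"
  by (induction ws) auto

lemma ex_weight_order:
  fixes w1 w2 :: "'n::finite \<Rightarrow> nat"
  obtains r where "monomial_order r"
    "\<And>u v. (u, v) \<in> r \<Longrightarrow> weight w1 u \<le> weight w1 v"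
    "\<And>u v. (u, v) \<in> r \<Longrightarrow> weight w1 u = weight w1 v \<Longrightarrow> weight w2 u \<le> weight w2 v"
proof -
  obtain xs where xs: "set xs = (UNIV :: 'n set)"
    using finite_list[of "UNIV :: 'n set"] by auto
  \<comment> \<open>The appended unit weights read off the single entries, which makes the relation
    antisymmetric; the enumeration \<open>xs\<close> of the variables is arbitrary.\<close>
  define ws where "ws = w1 # w2 # map (\<lambda>i j. of_bool (i = j)) xs"
  define r where "r = {(u, v). weights_le ws u v}"
  have "u = v" if "weights_le ws u v" "weights_le ws v u" for u v
  proof (rule poly_mapping_eqI)
    fix i
    have "(\<lambda>j. of_bool (i = j)) \<in> set ws"
      using xs by (auto simp: ws_def)
    from weights_le_antisym[OF that this] show "lookup u i = lookup v i"
      by (simp add: weight_unit)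
  qed
  then have "antisym r"
    by (simp add: antisym_def r_def)
  moreover have "refl r" "trans r" "total r"
    using weights_le_total[of ws]
    by (auto simp: r_def refl_on_def total_on_def weights_le_refl intro: transI weights_le_trans)
  ultimately have "linear_order r"
    by (simp add: order_on_defs)
  then have "monomial_order r"
    by (auto simp: monomial_order_def r_def weights_le_zero weights_le_add)
  then show ?thesis
    by (rule that) (auto simp: r_def ws_def)
qed

section \<open>Primitive binomials\<close>

lemma bit_vec_diff: "(a :: bit ^ 'n) - b = a + b"
  by (simp add: vec_eq_iff)

text \<open>Divisibility and ideal membership are traded for conditions on exponents and cosets, the
  form in which primitivity is proved and used below.\<close>

lemma primitive_code_ideal_iff:
  fixes C :: "(bit ^ 'n) set"
  assumes C: "vec.subspace C"
  shows "primitive C (code_ideal C :: ('n, 'a::field) mpoly set) c c' \<longleftrightarrow>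
    c \<noteq> 0 \<and> c' \<noteq> 0 \<and> supp c \<inter> supp c' = {} \<and> c - c' \<in> C \<and>
    (\<forall>u u'. u \<noteq> u' \<longrightarrow> parity u - parity u' \<in> C \<longrightarrow> lookup u \<le> lookup (expo c) \<longrightarrow>
       lookup u' \<le> lookup (expo c') \<longrightarrow> u = expo c \<and> u' = expo c')"
proof -
  have "(\<nexists>u u'. u \<noteq> u' \<and> (u, u') \<noteq> (expo c, expo c') \<and> parity u - parity u' \<in> C \<and>
      lookup u \<le> lookup (expo c) \<and> lookup u' \<le> lookup (expo c')) \<longleftrightarrow>
    (\<forall>u u'. u \<noteq> u' \<longrightarrow> parity u - parity u' \<in> C \<longrightarrow> lookup u \<le> lookup (expo c) \<longrightarrow>
       lookup u' \<le> lookup (expo c') \<longrightarrow> u = expo c \<and> u' = expo c')"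
    unfolding prod.inject by metis
  then show ?thesis
    unfolding primitive_def associated_binomial_def binomial_in_code_ideal_iff[OF C]
      monom_dvd_iff parity_expo by argo
qed

text \<open>In the squarefree case, \<open>standard_unique\<close> yields three properties: v is
  non-zero, the supports are disjoint, and no smaller binomial divides. A violation would produce
  distinct congruent standard exponents.\<close>

lemma (in code_order) min_nonstandard_primitive:
  assumes u: "min_nonstandard C r u" and v: "standard C r v" "parity v - parity u \<in> C"
    and no_weight_one: "\<And>c. c \<in> C \<Longrightarrow> hamming_weight c \<noteq> 1"
  shows "(\<exists>i. u = single i 2 \<and> v = 0) \<or>
    expo (parity u) = u \<and> expo (parity v) = v \<and>
    primitive C (code_ideal C :: ('n, 'a::field) mpoly set) (parity u) (parity v)"
  using u
proof (cases rule: min_nonstandard_cases)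
  case (1 i)
  then have "(v, 0) \<in> r"
    using v cong_sym[of v u] vec.subspace_neg[OF subspace v(2)] by (simp add: standard_def)
  then show ?thesis
    using 1 r_antisym r_zero by blast
next
  case 2
  have nonstd: "\<not> standard C r u"
    and below: "\<And>w. lookup w \<le> lookup u \<Longrightarrow> w \<noteq> u \<Longrightarrow> standard C r w"
    using u by (auto simp: min_nonstandard_def)
  have "lookup v i < 2" for i
    using v(1) standard_le[of v "single i 2"] nonstandard_single_2[of i]
    by (intro not_le_imp_less notI) (simp add: single_le_iff)
  then have v_free: "expo (parity v) = v"
    by (rule expo_parity_eq)
  have uv: "u \<noteq> v"
    using nonstd v by blast
  have u0: "parity u \<noteq> 0"
  proof
    assume "parity u = 0"
    then have "u = 0"
      using 2 by (metis expo_parity_eq lookup_zero parity_0 zero_less_numeral)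
    then show False
      using nonstd by (simp add: standard_def)
  qed
  \<comment> \<open>Otherwise u is a codeword of weight at least two. Splitting u as e_i + z gives
    two standard exponents, congruent because sum and difference agree modulo 2; their equality
    would make u = 2 e_i.\<close>
  have v0: "parity v \<noteq> 0"
  proof
    assume v0: "parity v = 0"
    then have uC: "parity u \<in> C"
      using vec.subspace_neg[OF subspace v(2)] by simp
    obtain i where "parity u $ i \<noteq> 0"
      using u0 by (auto simp: vec_eq_iff)
    then have "lookup (single i 1) \<le> lookup u"
      by (auto simp: single_le_iff of_nat_bit_eq intro: odd_pos Suc_leI split: if_splits)
    then obtain z where z: "u = single i 1 + z"
      by (auto simp: exponent_le_iff_add)
    have i: "lookup u i < 2"
      using lookup_expo[of "parity u" i] 2 by (simp split: if_splits)
    have "supp (parity (single i 1)) = {i}"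
      by (auto simp: supp_def lookup_single when_def)
    then have "u \<noteq> single i 1"
      using no_weight_one[OF uC] by (auto simp: hamming_weight_def)
    then have "standard C r (single i 1)"
      using below by (simp add: z le_fun_def lookup_add)
    moreover have "standard C r z"
      using below[of z] by (auto simp: z le_fun_def lookup_add)
    moreover have "parity (single i 1) - parity z \<in> C"
      using uC by (simp add: z parity_add bit_vec_diff)
    ultimately have "single i 1 = z"
      by (rule standard_unique)
    then show False
      using i z by (auto simp: lookup_add)
  qed
  \<comment> \<open>Cancelling a common variable keeps both exponents congruent and makes both
    standard, so the quotients agree, and with them u and v.\<close>
  have disj: "supp (parity u) \<inter> supp (parity v) = {}"
  proof (rule ccontr)
    assume "supp (parity u) \<inter> supp (parity v) \<noteq> {}"
    then obtain i where "parity u $ i \<noteq> 0" "parity v $ i \<noteq> 0"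
      by (auto simp: supp_def)
    then have "lookup (single i 1) \<le> lookup u" "lookup (single i 1) \<le> lookup v"
      by (auto simp: single_le_iff of_nat_bit_eq intro: odd_pos Suc_leI split: if_splits)
    then obtain y z where yz: "u = single i 1 + y" "v = single i 1 + z"
      unfolding exponent_le_iff_add by blast
    have "standard C r y"
      using below[of y] by (auto simp: yz le_fun_def lookup_add)
    moreover have "standard C r z"
      using v(1) by (rule standard_le) (simp add: yz le_fun_def lookup_add)
    moreover have "parity y - parity z \<in> C"
      using cong_sym[OF v(2)] by (simp add: yz parity_add)
    ultimately have "y = z"
      by (rule standard_unique)
    then show False
      using uv yz by simp
  qed
  have "w = u \<and> w' = v"
    if w: "w \<noteq> w'" "parity w - parity w' \<in> C" "lookup w \<le> lookup u" "lookup w' \<le> lookup v" for w w'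
  proof -
    have std: "standard C r w'"
      using standard_le v(1) w(4) by blast
    then have "w = u"
      using below w standard_unique by blast
    then show ?thesis
      using std v w(2) cong_trans standard_unique by blast
  qed
  then have "primitive C (code_ideal C :: ('n, 'a) mpoly set) (parity u) (parity v)"
    unfolding primitive_code_ideal_iff[OF subspace] 2 v_free
    using u0 v0 disj cong_sym[OF v(2)] by blast
  then show ?thesis
    using 2 v_free by blast
qed

section \<open>Orders realising the squares and the primitive binomials\<close>

lemma (in code_order) min_nonstandardI:
  assumes "\<not> standard C r u"
    and "\<And>v w. lookup v \<le> lookup u \<Longrightarrow> v \<noteq> u \<Longrightarrow> parity w - parity v \<in> C \<Longrightarrow> (w, v) \<in> r \<Longrightarrow> w = v"
  shows "min_nonstandard C r u"
proof -
  have "standard C r v" if "lookup v \<le> lookup u" "v \<noteq> u" for v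
    unfolding standard_def using assms(2)[OF that] r_total r_refl by blast
  then show ?thesis
    using assms(1) by (simp add: min_nonstandard_def)
qed

text \<open>The proper divisors 1 and x_i of x_i^2 must be standard. Comparing total degrees first
  leaves only variables x_j as competitors of x_i, which are congruent to it when e_i + e_j is a
  codeword of weight two. The second weight counts the degree outside x_i and so puts x_i below all
  of them.\<close>

lemma square_in_reduced_groebner_basis:
  fixes C :: "(bit ^ 'n) set"
  assumes C: "vec.subspace C"
    and no_weight_one: "\<And>c. c \<in> C \<Longrightarrow> hamming_weight c \<noteq> 1"
  obtains r where "monomial_order r" "min_nonstandard C r (single i 2)" "standard C r 0"
proof -
  obtain r where r: "monomial_order r"
    and r1: "\<And>u v. (u, v) \<in> r \<Longrightarrow> weight (\<lambda>_. 1) u \<le> weight (\<lambda>_. 1) v"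
    and r2: "\<And>u v. (u, v) \<in> r \<Longrightarrow> weight (\<lambda>_. 1) u = weight (\<lambda>_. 1) v \<Longrightarrow>
      weight (\<lambda>j. of_bool (j \<noteq> i)) u \<le> weight (\<lambda>j. of_bool (j \<noteq> i)) v"
    using ex_weight_order[of "\<lambda>_. 1" "\<lambda>j. of_bool (j \<noteq> i)"] by blast
  interpret code_order C r
    using C r by unfold_locales
  have "min_nonstandard C r (single i 2)"
  proof (rule min_nonstandardI[OF nonstandard_single_2])
    fix v w assume v: "lookup v \<le> lookup (single i 2)" "v \<noteq> single i 2"
      and wv: "parity w - parity v \<in> C" "(w, v) \<in> r"
    have "lookup v j = 0" if "j \<noteq> i" for j
      using v(1) that by (auto simp: le_fun_def lookup_single when_def dest!: spec[of _ j])
    then have v_eq: "v = single i (lookup v i)"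
      by (intro poly_mapping_eqI) (auto simp: lookup_single when_def)
    have "lookup v i \<le> 2"
      using v(1) by (auto simp: le_fun_def dest!: spec[of _ i])
    moreover have "lookup v i \<noteq> 2"
      using v(2) v_eq by auto
    ultimately have "lookup v i = 0 \<or> lookup v i = 1"
      by linarith
    then consider "v = 0" | "v = single i 1"
      using v_eq by (auto simp del: One_nat_def)
    then show "w = v"
    proof cases
      case 1
      then show ?thesis
        using wv(2) r_antisym r_zero by blast
    next
      case 2
      have wt: "weight (\<lambda>_. 1) v = 1" "weight (\<lambda>j. of_bool (j \<noteq> i)) v = 0"
        by (auto simp: 2 weight_def lookup_single when_def)
      have "weight (\<lambda>_. 1) w \<noteq> 0"
      proof
        assume "weight (\<lambda>_. 1) w = 0"
        then have "w = 0"
          by (intro poly_mapping_eqI) (simp add: weight_def)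
        then have "parity v \<in> C"
          using vec.subspace_neg[OF C wv(1)] by simp
        moreover have "supp (parity v) = {i}"
          by (auto simp: 2 supp_def lookup_single when_def)
        ultimately show False
          using no_weight_one by (force simp: hamming_weight_def)
      qed
      then have w1: "weight (\<lambda>_. 1) w = 1"
        using r1[OF wv(2)] wt(1) by simp
      then have "weight (\<lambda>j. of_bool (j \<noteq> i)) w = 0"
        using r2[OF wv(2)] wt by simp
      then have off: "lookup w j = 0" if "j \<noteq> i" for j
        using that by (auto simp: weight_def)
      have "weight (\<lambda>_. 1) w = (\<Sum>j\<in>UNIV. if j = i then lookup w i else 0)"
        unfolding weight_def using off by (intro sum.cong) auto
      then have "lookup w i = 1"
        using w1 by simp
      then show ?thesis
        using off by (intro poly_mapping_eqI) (auto simp: 2 lookup_single when_def)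
    qed
  qed
  moreover have "standard C r 0"
    by (simp add: standard_def)
  ultimately show ?thesis
    using r that by blast
qed

text \<open>Weighting the variables of \<open>c\<close> by \<open>\<bar>supp c'\<bar>\<close> and those of \<open>c'\<close> by \<open>\<bar>supp c\<bar>\<close> balances the
  two monomials; since \<open>c - c'\<close> is the only non-zero codeword supported on both of them, a monomial
  below a divisor of either one in its class can only be its complement in \<open>supp (c - c')\<close>, and
  this is excluded by weight unless the two monomials are \<open>c\<close> and \<open>c'\<close> themselves. The second
  weight breaks this tie in favour of \<open>c\<close> as leading monomial.\<close>

lemma primitive_in_reduced_groebner_basis:
  fixes C :: "(bit ^ 'n) set"
  assumes C: "vec.subspace C"
    and prim: "primitive C (code_ideal C :: ('n, 'a::field) mpoly set) c c'"
  obtains r where "monomial_order r" "min_nonstandard C r (expo c)" "standard C r (expo c')"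
proof -
  define a b where "a = card (supp c)" and "b = card (supp c')"
  \<comment> \<open>The value \<open>a * b + 1\<close> makes a single variable outside both supports
    heavier than either monomial, whose weight is \<open>a * b\<close>.\<close>
  define w1 where "w1 i = (if i \<in> supp c then b else if i \<in> supp c' then a else a * b + 1)" for i
  define w2 :: "'n \<Rightarrow> nat" where "w2 i = of_bool (i \<in> supp c)" for i
  have ne: "c \<noteq> 0" "c' \<noteq> 0" and disj: "supp c \<inter> supp c' = {}" and cc: "c - c' \<in> C"
    and minimal: "\<And>u u'. u \<noteq> u' \<Longrightarrow> parity u - parity u' \<in> C \<Longrightarrow> lookup u \<le> lookup (expo c) \<Longrightarrow>
       lookup u' \<le> lookup (expo c') \<Longrightarrow> u = expo c \<and> u' = expo c'"
    using iffD1[OF primitive_code_ideal_iff[OF C] prim] by simp_all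
  have pos: "0 < a" "0 < b"
    using ne by (auto simp: a_def b_def card_gt_0_iff supp_def vec_eq_iff)
  have w1_pos: "w1 i \<noteq> 0" for i
    using pos by (simp add: w1_def)
  have w1_c: "weight w1 (expo c) = a * b"
    by (simp add: weight_expo w1_def a_def)
  have "sum w1 (supp c') = (\<Sum>i\<in>supp c'. a)"
    using disj by (intro sum.cong) (auto simp: w1_def)
  then have w1_c': "weight w1 (expo c') = a * b"
    by (simp add: weight_expo b_def)
  have w2_c: "weight w2 (expo c) = a"
    by (simp add: weight_expo w2_def a_def)
  have "sum w2 (supp c') = 0"
    using disj by (auto simp: w2_def)
  then have w2_c': "weight w2 (expo c') = 0"
    by (simp add: weight_expo)
  \<comment> \<open>Cutting d along \<open>supp c\<close> gives parts x and y below c and c' with x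
    - y = d, to which minimality applies.\<close>
  have codeword: "d = c - c'" if d: "d \<in> C" "d \<noteq> 0" "supp d \<subseteq> supp c \<union> supp c'" for d
  proof -
    define x where "x = (\<chi> i. if i \<in> supp c then d $ i else 0)"
    define y where "y = (\<chi> i. if i \<in> supp c then 0 else d $ i)"
    have xy: "x - y = d"
      by (simp add: bit_vec_diff vec_eq_iff x_def y_def)
    have "x \<noteq> y"
      using d(2) xy by force
    moreover have "lookup (expo x) \<le> lookup (expo c)" "lookup (expo y) \<le> lookup (expo c')"
      using d(3) by (auto simp: le_fun_def lookup_expo x_def y_def supp_def)
    ultimately have "expo x = expo c \<and> expo y = expo c'"
      using minimal[of "expo x" "expo y"] d(1) xy by simp
    then show ?thesis
      using xy by simp
  qed
  obtain r where r: "monomial_order r"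
    and r1: "\<And>u v. (u, v) \<in> r \<Longrightarrow> weight w1 u \<le> weight w1 v"
    and r2: "\<And>u v. (u, v) \<in> r \<Longrightarrow> weight w1 u = weight w1 v \<Longrightarrow> weight w2 u \<le> weight w2 v"
    using ex_weight_order[of w1 w2] by blast
  interpret code_order C r
    using C r by unfold_locales
  \<comment> \<open>The first alternative serves minimality of \<open>expo c\<close>; the second
    includes \<open>expo c'\<close> itself and serves its standardness.\<close>
  have least: "w = v"
    if v: "lookup v \<le> lookup (expo c) \<and> v \<noteq> expo c \<or> lookup v \<le> lookup (expo c')"
      and wv: "parity w - parity v \<in> C" "(w, v) \<in> r" for v w
  proof -
    have "weight w1 v \<le> a * b"
      using v weight_mono w1_c w1_c' by metis
    then have w_le: "weight w1 w \<le> a * b"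
      using r1[OF wv(2)] by simp
    have w_out: "lookup w i = 0" if "i \<notin> supp c \<union> supp c'" for i
    proof (rule ccontr)
      assume "lookup w i \<noteq> 0"
      then have "w1 i \<le> weight w1 w"
        using weight_ge[of w1 i w] by (auto intro: order_trans[rotated])
      then show False
        using w_le that by (simp add: w1_def)
    qed
    have v_le: "lookup v i \<le> (if i \<in> supp c \<union> supp c' then 1 else 0)" for i
      using v by (auto simp: le_fun_def lookup_expo supp_def split: if_splits dest: spec[of _ i])
    have v_free: "expo (parity v) = v"
      by (rule expo_parity_eq, rule le_less_trans[OF v_le]) simp
    have "supp (parity w - parity v) \<subseteq> supp c \<union> supp c'"
    proof
      fix i assume "i \<in> supp (parity w - parity v)"
      then have "\<not> (lookup w i = 0 \<and> lookup v i = 0)"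
        by (intro notI) (simp add: supp_def)
      then show "i \<in> supp c \<union> supp c'"
        using w_out[of i] v_le[of i] by (auto split: if_splits)
    qed
    then have "parity w - parity v = 0 \<or> parity w - parity v = c - c'"
      using codeword[OF wv(1)] by blast
    then consider "parity w = parity v" | "parity w - parity v = c - c'"
      unfolding right_minus_eq by blast
    then show "w = v"
    proof cases
      case 1
      then have "lookup v \<le> lookup w"
        using expo_parity_le[of w] v_free by simp
      then show ?thesis
        using r_of_le r_antisym wv(2) by blast
    next
      case 2
      \<comment> \<open>Modulo 2 the sum w + v equals c + c', so every variable of the two disjoint
        supports occurs in w + v. The total weight is thus at least \<open>2 * (a * b)\<close> while
        each summand has at most \<open>a * b\<close>, which forces equality.\<close>
      have "lookup (expo c + expo c') \<le> lookup (w + v)"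
      proof (rule le_funI)
        fix i
        have "parity (w + v) $ i = (c + c') $ i"
          using 2 by (simp add: parity_add bit_vec_diff)
        moreover have "c $ i = 0 \<or> c' $ i = 0"
          using disj by (auto simp: supp_def)
        ultimately show "lookup (expo c + expo c') i \<le> lookup (w + v) i"
          by (cases "lookup w i"; cases "lookup v i")
            (auto simp: lookup_add lookup_expo split: if_splits)
      qed
      from weight_mono[OF this, of w1] have "2 * (a * b) \<le> weight w1 w + weight w1 v"
        by (simp add: weight_add w1_c w1_c')
      then have wt: "weight w1 w = a * b" "weight w1 v = a * b"
        using w_le \<open>weight w1 v \<le> a * b\<close> by auto
      \<comment> \<open>All values of \<open>w1\<close> are positive, so a divisor of the same
        weight is the whole monomial.\<close>
      have eq: "v = x" if "lookup v \<le> lookup x" "weight w1 x = a * b" for x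
      proof -
        obtain z where z: "x = v + z"
          using \<open>lookup v \<le> lookup x\<close> by (auto simp: exponent_le_iff_add)
        then have "weight w1 z = 0"
          using that(2) wt by (simp add: weight_add)
        then have "z = 0"
          using w1_pos by (intro poly_mapping_eqI) (auto simp: weight_def)
        then show ?thesis using z by simp
      qed
      have "v = expo c'"
        using v eq w1_c w1_c' by blast
      \<comment> \<open>Now w is divisible by \<open>expo c\<close> and has second weight at least
        a, whereas v has second weight 0; this contradicts w lying below v at equal first
        weight.\<close>
      then have "parity w = c"
        using 2 by simp
      then have "a \<le> weight w2 w"
        using weight_mono[OF expo_parity_le, of w2 w] w2_c by simp
      moreover have "weight w2 w \<le> weight w2 v"
        using r2 wv(2) wt by simp
      ultimately have False
        using pos \<open>v = expo c'\<close> w2_c' by simp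
      then show ?thesis ..
    qed
  qed
  have std: "standard C r (expo c')"
    unfolding standard_def using least[OF disjI2[OF order_refl]] r_total r_refl by blast
  have "\<not> standard C r (expo c)"
  proof
    assume "standard C r (expo c)"
    then have "expo c = expo c'"
      using std cc by (intro standard_unique) simp_all
    then show False
      using disj ne by (auto simp: supp_def vec_eq_iff)
  qed
  then have "min_nonstandard C r (expo c)"
    using least by (intro min_nonstandardI) blast+
  then show ?thesis
    using std r that by blast
qed

theorem corollary5:
  fixes C :: "(bit ^ 'n) set" and G :: "bit ^ 'n ^ 'k"
  assumes code: "binary_code CARD('k) C"
    and generator: "generator_matrix G C"
    and no_zero_column: "\<And>j. column j G \<noteq> 0"
    and no_weight_one: "\<And>c. c \<in> C \<Longrightarrow> hamming_weight c \<noteq> 1"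
  shows "universal_groebner_basis (code_ideal C :: ('n, 'a::field) mpoly set)
           = primitive_binomials C"
proof -
  have C: "vec.subspace C"
    using code by (simp add: binary_code_def)
  let ?I = "code_ideal C :: ('n, 'a) mpoly set"
  show ?thesis
    unfolding universal_groebner_basis_code_ideal[OF C] primitive_binomials_def
  proof (intro equalityI subsetI)
    fix g :: "('n, 'a) mpoly"
    assume "g \<in> {monom u - monom v | u v. \<exists>r. monomial_order r \<and> min_nonstandard C r u \<and>
       standard C r v \<and> parity v - parity u \<in> C}"
    then obtain u v r where g: "g = monom u - monom v" and r: "monomial_order r"
      and uv: "min_nonstandard C r u" "standard C r v" "parity v - parity u \<in> C"
      by blast
    interpret code_order C r
      using C r by unfold_locales
    consider i where "u = single i 2" "v = 0"
      | "expo (parity u) = u" "expo (parity v) = v" "primitive C ?I (parity u) (parity v)"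
      using min_nonstandard_primitive[OF uv no_weight_one] by blast
    then show "g \<in> {monom (expo c) - monom (expo c') | c c'. primitive C ?I c c'} \<union>
        {(var i)\<^sup>2 - 1 | i. True}"
    proof cases
      case 1
      then show ?thesis
        by (auto simp: g var_square)
    next
      case 2
      then have "g = monom (expo (parity u)) - monom (expo (parity v))"
        by (simp add: g)
      then show ?thesis
        using 2(3) by blast
    qed
  next
    fix g :: "('n, 'a) mpoly"
    assume "g \<in> {monom (expo c) - monom (expo c') | c c'. primitive C ?I c c'} \<union>
        {(var i)\<^sup>2 - 1 | i. True}"
    then consider c c' where "g = monom (expo c) - monom (expo c')" "primitive C ?I c c'"
      | i where "g = monom (single i 2) - monom 0"
      by (auto simp: var_square)
    then show "g \<in> {monom u - monom v | u v. \<exists>r. monomial_order r \<and> min_nonstandard C r u \<and>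
       standard C r v \<and> parity v - parity u \<in> C}"
    proof cases
      case 1
      obtain r where "monomial_order r" "min_nonstandard C r (expo c)" "standard C r (expo c')"
        using primitive_in_reduced_groebner_basis[OF C 1(2)] .
      moreover have "c' - c \<in> C"
        using 1(2) vec.subspace_neg[OF C, of "c - c'"] by (simp add: primitive_code_ideal_iff[OF C])
      ultimately show ?thesis
        unfolding 1(1)
        by (intro CollectI exI[of _ "expo c"] exI[of _ "expo c'"] conjI refl) auto
    next
      case 2
      obtain r where "monomial_order r" "min_nonstandard C r (single i 2)" "standard C r 0"
        using square_in_reduced_groebner_basis[OF C no_weight_one] .
      moreover have "parity 0 - parity (single i 2) \<in> C"
        using vec.subspace_0[OF C] by simp
      ultimately show ?thesis
        using 2 by blast
    qed
  qed
qed

end
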